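(* Let $S: Ax=b$ be a system of linear equations, where $A\in M_{6\times 4}(\mathbb{Z})$. Suppose that $S=\{s_1,\dots,s_N\}\subset\mathbb{Z}^4$ is the set of solutions of the linear system. If the system is given by $$\begin{pmatrix} a_{11}&-a_{12}&a_{13}&-a_{14}\\ a_{21}&-a_{22}&a_{23}&0\\ -3a_{31}&0&a_{33}&0\\ a_{41}&-a_{42}&a_{43}&-a_{44}\\ a_{51}&-a_{52}&a_{53}&0\\ -3a_{61}&0&a_{63}&0\end{pmatrix}\begin{pmatrix}c_1\\c_2\\c_3\\c_4\end{pmatrix}=\begin{pmatrix}1\\-1\\-1\\1\\-1\\-1\end{pmatrix}$$ and the entries satisfy $a_{11}=a_{21}=a_{31}$, $a_{12}=a_{22}$, $a_{13}=a_{23}=a_{33}$, $a_{41}=a_{51}=a_{61}$, $a_{42}=a_{52}$, $a_{43}=a_{53}=a_{63}$, and $s_i=(c_1,c_2,c_3,c_4)\in S$, then there exist elliptic curves $$E_{s_i}: Y^2=a_{11}c_1X^3+a_{12}c_2X^2+a_{13}c_3X+a_{14}c_4,$$ $$C_{s_i}: Y^2=a_{41}c_1X^3+a_{42}c_2X^2+a_{43}c_3X+a_{44}c_4.$$ If $x>1$ and $y\ge 1$ hold for all $(x,y)\in E_{s_i}(\mathbb{Z}^+)$ and all $(x,y)\in C_{s_i}(\mathbb{Z}^+)$, then $$\{E_{s_i}(\mathbb{Z}^+)\}_{i=1}^N=\emptyset,\qquad \{C_{s_i}(\mathbb{Z}^+)\}_{i=1}^N=\emptyset,$$ that is, $E_{s_i}(\mathbb{Z}^+)=\emptyset$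 and $C_{s_i}(\mathbb{Z}^+)=\emptyset$ for every $i=1,\dots,N$.
   Context: The $a_{ij}$ are integers. The letter $S$ denotes both the linear system and its set of solutions. For a curve $E$ given by an equation in $X,Y$ with integer coefficients, $E(\mathbb{Z}^+)$ denotes the set of points $(x,y)$ on $E$ whose coordinates are positive integers; likewise for $C_{s_i}(\mathbb{Z}^+)$.
   Formalization: That E_{s_i} (resp. C_{s_i}) is an elliptic curve is claimed only when its X^3 coefficient a_11 c_1 (resp. a_41 c_1) is nonzero; otherwise the equation is Y^2 = -X-2, which is not elliptic. The emptiness claims are kept for every i. *)

theory Defs
  imports "HOL-Analysis.Analysis"
begin

text \<open>\<^term>\<open>Cubic \<alpha> \<beta> \<gamma> \<delta>\<close> stands for the equation
  \<open>Y\<^sup>2 = \<alpha> X\<^sup>3 + \<beta> X\<^sup>2 + \<gamma> X + \<delta>\<close>; the leading coefficient may be zero.\<close>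

datatype cubic_curve = Cubic int int int int

fun positive_integer_points :: "cubic_curve \<Rightarrow> (int \<times> int) set" where
  "positive_integer_points (Cubic \<alpha> \<beta> \<gamma> \<delta>) =
     {(x, y). x > 0 \<and> y > 0 \<and> y ^ 2 = \<alpha> * x ^ 3 + \<beta> * x ^ 2 + \<gamma> * x + \<delta>}"

text \<open>The homogeneous cubic form defining the projective closure of the curve.\<close>

fun cubic_form :: "cubic_curve \<Rightarrow> complex \<Rightarrow> complex \<Rightarrow> complex \<Rightarrow> complex" where
  "cubic_form (Cubic \<alpha> \<beta> \<gamma> \<delta>) X Y Z =
     Y ^ 2 * Z - (of_int \<alpha> * X ^ 3 + of_int \<beta> * X ^ 2 * Z + of_int \<gamma> * X * Z ^ 2 + of_int \<delta> * Z ^ 3)"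

text \<open>An elliptic curve over the rationals, given as a plane cubic: the projective closure is
  smooth at every complex point, and the point \<open>[0 : 1 : 0]\<close> lies on every such closure, so a
  rational point need not be required separately. By Euler's identity a nonzero common zero of the
  partial derivatives lies on the curve. If the leading coefficient is zero, the line at infinity
  is a component and the closure is singular, so this case is excluded.\<close>

definition elliptic_curve :: "cubic_curve \<Rightarrow> bool" where
  "elliptic_curve E \<longleftrightarrow>
     (\<forall>X Y Z :: complex. (X, Y, Z) \<noteq> (0, 0, 0) \<longrightarrow>
        \<not> (deriv (\<lambda>t. cubic_form E t Y Z) X = 0 \<and>
           deriv (\<lambda>t. cubic_form E X t Z) Y = 0 \<and>
           deriv (\<lambda>t. cubic_form E X Y t) Z = 0))"

end

theory Submission
  imports Defs
begin

text \<open>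
  The first three equations, with the coincidences among the entries, express the four
  coefficients of the first curve through \<open>\<alpha> = a\<^sub>1\<^sub>1 c\<^sub>1\<close> alone: they are \<open>\<alpha>, 4\<alpha>, 3\<alpha> - 1, -2\<close>.
  The last three equations do the same for the second curve. So every curve is
  \<open>Y\<^sup>2 = \<alpha>X(X + 1)(X + 3) - (X + 2)\<close> for some integer \<open>\<alpha>\<close>.

  If \<open>\<alpha> \<noteq> 0\<close>, the curve is elliptic because the discriminant of the cubic is, up to nonzero factors,
  \<open>9\<alpha>\<^sup>3 + 23\<alpha>\<^sup>2 + 4\<alpha> + 1\<close>, which has no integer zero.

  If \<open>(x, y)\<close> is an integer point with \<open>x > 0\<close>, then \<open>x\<close> divides \<open>y\<^sup>2 + 2\<close> and \<open>x + 1\<close> divides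
  \<open>y\<^sup>2 + 1\<close>. A positive divisor of \<open>y\<^sup>2 + 1\<close> is neither divisible by 4 nor congruent to 3
  modulo 4, and \<open>y\<^sup>2 + 2\<close> is not divisible by 4; this leaves \<open>x \<equiv> 1\<close> modulo 4. Half of \<open>x + 1\<close> is
  then an odd divisor of \<open>y\<^sup>2 + 1\<close>, hence congruent to 1 modulo 4, and so \<open>x \<equiv> 1\<close> modulo 8.
  Now \<open>(x + 1)(x + 3)\<close> is divisible by 8 and the equation gives \<open>y\<^sup>2 \<equiv> -3\<close> modulo 8, which is
  impossible for a square. The argument holds for every integer \<open>\<alpha>\<close>, zero included.
\<close>

section \<open>Integer points\<close>

text \<open>
  Fermat descent, which avoids factoring \<open>n\<close> into primes. Modulo \<open>n\<close>, the number \<open>y\<close> can be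
  replaced by an even \<open>z\<close> with \<open>0 \<le> z < n\<close>, since \<open>n\<close> is odd and one of \<open>y mod n\<close> and
  \<open>n - y mod n\<close> is even. The cofactor of \<open>n\<close> in \<open>z\<^sup>2 + 1 \<equiv> 1\<close> modulo 4 is again congruent to 3
  modulo 4, and it is smaller than \<open>n\<close>.
\<close>

lemma three_mod_four_not_dvd_square_plus_one:
  fixes n y :: int
  assumes "n > 0" "n mod 4 = 3"
  shows "\<not> n dvd y ^ 2 + 1"
  using assms
proof (induction "nat n" arbitrary: n y rule: less_induct)
  case less
  show ?case
  proof
    assume dvd: "n dvd y ^ 2 + 1"
    define r where "r = y mod n"
    define z where "z = (if even r then r else n - r)"
    have "odd n" using less.prems by presburger
    have r: "0 \<le> r" "r < n" using less.prems by (auto simp: r_def)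
    have z: "even z" "0 \<le> z" "z \<le> n - 1"
      using r \<open>odd n\<close> by (auto simp: z_def elim: oddE)
    have "n dvd y - r" by (simp add: r_def mod_eq_dvd_iff[symmetric])
    then have "n dvd y ^ 2 - r ^ 2"
      by (simp add: power2_eq_square square_diff_square_factored)
    moreover have "n dvd r ^ 2 - z ^ 2"
      by (simp add: z_def power2_eq_square square_diff_square_factored)
    ultimately have "n dvd (y ^ 2 + 1) - (y ^ 2 - r ^ 2) - (r ^ 2 - z ^ 2)"
      using dvd by (meson dvd_diff)
    then have "n dvd z ^ 2 + 1" by (simp add: algebra_simps)
    then obtain k where k: "z ^ 2 + 1 = n * k" by blast
    have "0 < n * k" using k[symmetric] by (simp add: add_nonneg_pos)
    then have "k > 0" using less.prems by (simp add: zero_less_mult_iff)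
    have "n \<ge> 3" using less.prems by presburger
    have "z ^ 2 \<le> (n - 1) ^ 2" using z by (intro power_mono) auto
    also have "(n - 1) ^ 2 = n * n - 2 * n + 1" by (simp add: power2_eq_square algebra_simps)
    finally have "n * k < n * n" using k \<open>n \<ge> 3\<close> by linarith
    then have "k < n" using less.prems by simp
    obtain w where w: "z = 2 * w" using z by blast
    define q where "q = n div 4"
    have q: "n = 4 * q + 3" using less.prems unfolding q_def by presburger
    have "4 * w ^ 2 + 1 = (4 * q + 3) * k" using k unfolding w q by (simp add: power_mult_distrib)
    then have "4 * (w ^ 2 - q * k) + 1 = 3 * k" by (simp add: algebra_simps)
    then have "k mod 4 = 3" by presburger
    then show False
      using less.hyps[of k z] k \<open>k > 0\<close> \<open>k < n\<close> by simp
  qed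
qed

lemma square_mod_8:
  fixes y :: int
  shows "y ^ 2 mod 8 \<in> {0, 1, 4}"
proof -
  have "y mod 8 \<in> {0, 1, 2, 3, 4, 5, 6, 7}" by auto
  then have "(y mod 8) ^ 2 mod 8 \<in> {0, 1, 4}" by auto
  then show ?thesis by (simp add: power_mod)
qed

lemma no_integer_point_with_positive_abscissa:
  fixes \<alpha> x y :: int
  assumes "x > 0"
  shows "y ^ 2 \<noteq> \<alpha> * x ^ 3 + 4 * \<alpha> * x ^ 2 + (3 * \<alpha> - 1) * x - 2"
proof
  assume "y ^ 2 = \<alpha> * x ^ 3 + 4 * \<alpha> * x ^ 2 + (3 * \<alpha> - 1) * x - 2"
  then have eq: "y ^ 2 = \<alpha> * x * (x + 1) * (x + 3) - (x + 2)"
    by (simp add: algebra_simps power2_eq_square power3_eq_cube)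
  have "y ^ 2 + 2 = x * (\<alpha> * (x + 1) * (x + 3) - 1)"
    unfolding eq by (simp add: algebra_simps)
  then have x_dvd: "x dvd y ^ 2 + 2" by simp
  have "y ^ 2 + 1 = (x + 1) * (\<alpha> * x * (x + 3) - 1)"
    unfolding eq by (simp add: algebra_simps)
  then have x1_dvd: "x + 1 dvd y ^ 2 + 1" by simp
  have sq: "y ^ 2 mod 8 \<in> {0, 1, 4}" by (rule square_mod_8)
  have "\<not> 4 dvd x"
  proof
    assume "4 dvd x"
    then have "4 dvd y ^ 2 + 2" using x_dvd by (rule dvd_trans)
    with sq show False by auto presburger+
  qed
  moreover have "\<not> 4 dvd x + 1"
  proof
    assume "4 dvd x + 1"
    then have "4 dvd y ^ 2 + 1" using x1_dvd by (rule dvd_trans)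
    with sq show False by auto presburger+
  qed
  moreover have "(x + 1) mod 4 \<noteq> 3"
    using three_mod_four_not_dvd_square_plus_one[of "x + 1" y] x1_dvd assms by auto
  ultimately have x_mod_4: "x mod 4 = 1" by presburger
  define m where "m = (x + 1) div 2"
  have m: "x + 1 = 2 * m" using x_mod_4 unfolding m_def by presburger
  then have "m > 0" using assms by linarith
  have "m dvd y ^ 2 + 1" using x1_dvd unfolding m by (rule dvd_mult_right)
  then have "m mod 4 \<noteq> 3"
    using three_mod_four_not_dvd_square_plus_one[of m y] \<open>m > 0\<close> by blast
  moreover have "odd m" using m x_mod_4 by presburger
  ultimately have "m mod 4 = 1" by presburger
  define k where "k = m div 4"
  have "m = 4 * k + 1" using \<open>m mod 4 = 1\<close> unfolding k_def by presburger
  then have x: "x = 8 * k + 1" using m by simp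
  have "y ^ 2 = 8 * (\<alpha> * (8 * k + 1) * (4 * k + 1) * (2 * k + 1) - k - 1) + 5"
    unfolding eq x by (simp add: algebra_simps)
  then have "y ^ 2 mod 8 = 5" by presburger
  with sq show False by simp
qed

section \<open>Smoothness\<close>

lemma deriv_cubic_form:
  "deriv (\<lambda>t. cubic_form (Cubic \<alpha> \<beta> \<gamma> \<delta>) t Y Z) X =
     - (3 * of_int \<alpha> * X ^ 2 + 2 * of_int \<beta> * X * Z + of_int \<gamma> * Z ^ 2)"
  "deriv (\<lambda>t. cubic_form (Cubic \<alpha> \<beta> \<gamma> \<delta>) X t Z) Y = 2 * Y * Z"
  "deriv (\<lambda>t. cubic_form (Cubic \<alpha> \<beta> \<gamma> \<delta>) X Y t) Z =
     Y ^ 2 - (of_int \<beta> * X ^ 2 + 2 * of_int \<gamma> * X * Z + 3 * of_int \<delta> * Z ^ 2)"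
  by (rule DERIV_imp_deriv; simp;
      (rule derivative_eq_intros refl)+; simp add: algebra_simps power2_eq_square)+

text \<open>
  Only \<open>\<alpha> = 1\<close> and \<open>\<alpha> = -1\<close> could be integer zeros of \<open>9\<alpha>\<^sup>3 + 23\<alpha>\<^sup>2 + 4\<alpha> + 1\<close>, as such a zero
  divides the constant term.
\<close>

lemma discriminant_factor_nonzero:
  fixes \<alpha> :: int
  shows "9 * \<alpha> ^ 3 + 23 * \<alpha> ^ 2 + 4 * \<alpha> + 1 \<noteq> 0"
proof
  assume zero: "9 * \<alpha> ^ 3 + 23 * \<alpha> ^ 2 + 4 * \<alpha> + 1 = 0"
  then have "\<alpha> * - (9 * \<alpha> ^ 2 + 23 * \<alpha> + 4) = 1"
    by (simp add: algebra_simps power2_eq_square power3_eq_cube)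
  then have "\<alpha> dvd 1" by (metis dvd_triv_left)
  then have "\<alpha> = 1 \<or> \<alpha> = -1" by auto
  with zero show False by auto
qed

lemma elliptic_curve_family:
  assumes "\<alpha> \<noteq> 0"
  shows "elliptic_curve (Cubic \<alpha> (4 * \<alpha>) (3 * \<alpha> - 1) (- 2))"
  unfolding elliptic_curve_def deriv_cubic_form
proof (intro allI impI notI, elim conjE)
  fix X Y Z :: complex
  define a :: complex where "a = of_int \<alpha>"
  assume nz: "(X, Y, Z) \<noteq> (0, 0, 0)"
    and "- (3 * of_int \<alpha> * X ^ 2 + 2 * of_int (4 * \<alpha>) * X * Z + of_int (3 * \<alpha> - 1) * Z ^ 2) = 0"
    and dY: "2 * Y * Z = 0"
    and "Y ^ 2 - (of_int (4 * \<alpha>) * X ^ 2 + 2 * of_int (3 * \<alpha> - 1) * X * Z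
           + 3 * of_int (- 2) * Z ^ 2) = 0"
  then have dX: "3 * a * X ^ 2 + 8 * a * X * Z + (3 * a - 1) * Z ^ 2 = 0"
    and dZ: "Y ^ 2 = 4 * a * X ^ 2 + 2 * (3 * a - 1) * X * Z - 6 * Z ^ 2"
    by (simp_all add: a_def neg_eq_iff_add_eq_0 add_eq_0_iff)
  have "a \<noteq> 0" using assms by (simp add: a_def)
  show False
  proof (cases "Z = 0")
    case True
    then show False using dX dZ nz \<open>a \<noteq> 0\<close> by simp
  next
    case False
    then have "Y = 0" using dY by simp
    then have dZ': "2 * a * X ^ 2 + (3 * a - 1) * X * Z - 3 * Z ^ 2 = 0"
      using dZ by algebra
    \<comment> \<open>The factor before \<open>Z\<^sup>3\<close> is, up to sign, the resultant of the quadratic forms in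
      \<open>X\<close> and \<open>Z\<close> in \<open>dX\<close> and \<open>dZ'\<close>.\<close>
    have "3 * a * (9 * a ^ 3 + 23 * a ^ 2 + 4 * a + 1) * Z ^ 3 = 0"
      using dX dZ' by algebra
    then have "9 * a ^ 3 + 23 * a ^ 2 + 4 * a + 1 = 0"
      using False \<open>a \<noteq> 0\<close> by simp
    then have "(of_int (9 * \<alpha> ^ 3 + 23 * \<alpha> ^ 2 + 4 * \<alpha> + 1) :: complex) = 0"
      by (simp add: a_def)
    then show False using discriminant_factor_nonzero[of \<alpha>] by (simp only: of_int_eq_0_iff)
  qed
qed

section \<open>The linear system\<close>

lemma coefficients_of_block:
  fixes \<alpha> \<beta> \<gamma> \<delta> :: int
  assumes "\<alpha> - \<beta> + \<gamma> - \<delta> = 1" "\<alpha> - \<beta> + \<gamma> = - 1" "- 3 * \<alpha> + \<gamma> = - 1"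
  shows "Cubic \<alpha> \<beta> \<gamma> \<delta> = Cubic \<alpha> (4 * \<alpha>) (3 * \<alpha> - 1) (- 2)"
  using assms by simp

lemma block_curve:
  fixes \<alpha> \<beta> \<gamma> \<delta> :: int
  assumes "\<alpha> - \<beta> + \<gamma> - \<delta> = 1" "\<alpha> - \<beta> + \<gamma> = - 1" "- 3 * \<alpha> + \<gamma> = - 1"
  shows "\<alpha> \<noteq> 0 \<longrightarrow> elliptic_curve (Cubic \<alpha> \<beta> \<gamma> \<delta>)"
    and "positive_integer_points (Cubic \<alpha> \<beta> \<gamma> \<delta>) = {}"
  unfolding coefficients_of_block[OF assms]
  using elliptic_curve_family no_integer_point_with_positive_abscissa[of _ _ \<alpha>] by auto

lemma vector_4:
  fixes x1 x2 x3 x4 :: "'a::zero"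
  shows "(vector [x1, x2, x3, x4] :: 'a ^ 4) $ 1 = x1"
    "(vector [x1, x2, x3, x4] :: 'a ^ 4) $ 2 = x2"
    "(vector [x1, x2, x3, x4] :: 'a ^ 4) $ 3 = x3"
    "(vector [x1, x2, x3, x4] :: 'a ^ 4) $ 4 = x4"
  unfolding vector_def by simp_all

lemma vector_6:
  fixes x1 x2 x3 x4 x5 x6 :: "'a::zero"
  shows "(vector [x1, x2, x3, x4, x5, x6] :: 'a ^ 6) $ 1 = x1"
    "(vector [x1, x2, x3, x4, x5, x6] :: 'a ^ 6) $ 2 = x2"
    "(vector [x1, x2, x3, x4, x5, x6] :: 'a ^ 6) $ 3 = x3"
    "(vector [x1, x2, x3, x4, x5, x6] :: 'a ^ 6) $ 4 = x4"
    "(vector [x1, x2, x3, x4, x5, x6] :: 'a ^ 6) $ 5 = x5"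
    "(vector [x1, x2, x3, x4, x5, x6] :: 'a ^ 6) $ 6 = x6"
  unfolding vector_def by simp_all

theorem theorem12:
  fixes a :: "nat \<Rightarrow> nat \<Rightarrow> int"
    and A :: "int ^ 4 ^ 6" and b :: "int ^ 6"
    and S :: "(int ^ 4) set" and s :: "nat \<Rightarrow> int ^ 4" and N :: nat
  assumes A: "A = vector
     [vector [      a 1 1, - (a 1 2), a 1 3, - (a 1 4)],
      vector [      a 2 1, - (a 2 2), a 2 3,         0],
      vector [- 3 * a 3 1,         0, a 3 3,         0],
      vector [      a 4 1, - (a 4 2), a 4 3, - (a 4 4)],
      vector [      a 5 1, - (a 5 2), a 5 3,         0],
      vector [- 3 * a 6 1,         0, a 6 3,         0]]"
    and b: "b = vector [1, - 1, - 1, 1, - 1, - 1]"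
    and S: "S = {c. A *v c = b}"
    and S_enum: "S = s ` {1..N}"
    and "a 1 1 = a 2 1" "a 2 1 = a 3 1"
    and "a 1 2 = a 2 2"
    and "a 1 3 = a 2 3" "a 2 3 = a 3 3"
    and "a 4 1 = a 5 1" "a 5 1 = a 6 1"
    and "a 4 2 = a 5 2"
    and "a 4 3 = a 5 3" "a 5 3 = a 6 3"
  shows "\<exists>E C :: nat \<Rightarrow> cubic_curve. \<forall>i \<in> {1..N}.
     E i = Cubic (a 1 1 * s i $ 1) (a 1 2 * s i $ 2) (a 1 3 * s i $ 3) (a 1 4 * s i $ 4) \<and>
     C i = Cubic (a 4 1 * s i $ 1) (a 4 2 * s i $ 2) (a 4 3 * s i $ 3) (a 4 4 * s i $ 4) \<and>
     (a 1 1 * s i $ 1 \<noteq> 0 \<longrightarrow> elliptic_curve (E i)) \<and>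
     (a 4 1 * s i $ 1 \<noteq> 0 \<longrightarrow> elliptic_curve (C i)) \<and>
     ((\<forall>(x, y) \<in> positive_integer_points (E i). x > 1 \<and> y \<ge> 1) \<and>
      (\<forall>(x, y) \<in> positive_integer_points (C i). x > 1 \<and> y \<ge> 1) \<longrightarrow>
        positive_integer_points (E i) = {} \<and> positive_integer_points (C i) = {})"
proof (intro exI ballI conjI)
  fix i assume "i \<in> {1..N}"
  then have "A *v s i = b" using S S_enum by blast
  then have rows: "(A *v s i) $ j = b $ j" for j by simp
  have "a 1 1 * s i $ 1 - a 1 2 * s i $ 2 + a 1 3 * s i $ 3 - a 1 4 * s i $ 4 = 1"
    "a 1 1 * s i $ 1 - a 1 2 * s i $ 2 + a 1 3 * s i $ 3 = - 1"
    "- 3 * (a 1 1 * s i $ 1) + a 1 3 * s i $ 3 = - 1"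
    using rows[of 1] rows[of 2] rows[of 3] assms(5-9)
    by (simp_all add: A b matrix_vector_mult_def sum_4 vector_4 vector_6)
  note E = block_curve[OF this]
  have "a 4 1 * s i $ 1 - a 4 2 * s i $ 2 + a 4 3 * s i $ 3 - a 4 4 * s i $ 4 = 1"
    "a 4 1 * s i $ 1 - a 4 2 * s i $ 2 + a 4 3 * s i $ 3 = - 1"
    "- 3 * (a 4 1 * s i $ 1) + a 4 3 * s i $ 3 = - 1"
    using rows[of 4] rows[of 5] rows[of 6] assms(10-14)
    by (simp_all add: A b matrix_vector_mult_def sum_4 vector_4 vector_6)
  note C = block_curve[OF this]
  let ?E = "\<lambda>i. Cubic (a 1 1 * s i $ 1) (a 1 2 * s i $ 2) (a 1 3 * s i $ 3) (a 1 4 * s i $ 4)"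
  let ?C = "\<lambda>i. Cubic (a 4 1 * s i $ 1) (a 4 2 * s i $ 2) (a 4 3 * s i $ 3) (a 4 4 * s i $ 4)"
  show "?E i = ?E i" "?C i = ?C i" by (rule refl)+
  show "a 1 1 * s i $ 1 \<noteq> 0 \<longrightarrow> elliptic_curve (?E i)"
    "a 4 1 * s i $ 1 \<noteq> 0 \<longrightarrow> elliptic_curve (?C i)"
    by (rule E C)+
  show "(\<forall>(x, y) \<in> positive_integer_points (?E i). x > 1 \<and> y \<ge> 1) \<and>
      (\<forall>(x, y) \<in> positive_integer_points (?C i). x > 1 \<and> y \<ge> 1) \<longrightarrow>
      positive_integer_points (?E i) = {} \<and> positive_integer_points (?C i) = {}"
    using E(2) C(2) by blast
qed

end
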